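(* There exist instances of the online resource allocation problem in the i.i.d. model with $\gamma = \frac{\epsilon^2}{\log n}$ such that no online algorithm, even one with complete knowledge of the distribution, achieves an approximation factor of $1-o(\epsilon)$.
   Context: Online resource allocation problem: $n$ resources with capacities $c_i>0$; each request $j$ can be served by one option $k$ from a finite set, or dropped; option $k$ for request $j$ consumes $a_{ijk}\geq0$ of resource $i$ and yields type-$i$ profit $w_{ijk}\geq 0$. $m$ requests arrive one by one, drawn i.i.d. from a distribution over request types ($p_j$ the probability of type $j$), and each must be irrevocably served or dropped on arrival; total consumption of resource $i$ may not exceed $c_i$, and the objective is $\min_i$(total type-$i$ profit). $W_{E}$ is the optimal value of the expected-instance LP: maximize $\lambda$ s.t. $\sum_{j,k} m p_j w_{ijk}x_{jk}\geq\lambda$ and $\sum_{j,k} m p_j a_{ijk}x_{jk}\leq c_i$ for all $i$, $\sum_k x_{jk}\leq 1$, $x\geq 0$. $\gamma=\max(\{a_{ijk}/c_i\}\cup\{w_{ijk}/W_{E}\})$. The approximation factor of an algorithm is the ratio of its expected objective value to $W_{E}$. *)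

theory Defs
  imports "HOL-Probability.Probability" "HOL-Library.Landau_Symbols"
begin

record allocation_instance =
  num_resources :: nat
  num_requests :: nat
  types :: "nat set"
  options :: "nat set"
  type_pmf :: "nat pmf"
  capacity :: "nat \<Rightarrow> real"
  consumption :: "nat \<Rightarrow> nat \<Rightarrow> nat \<Rightarrow> real"
  profit :: "nat \<Rightarrow> nat \<Rightarrow> nat \<Rightarrow> real"

text \<open>
  Resources are indexed by \<open>{..<num_resources I}\<close>; \<open>consumption I i j k\<close> and
  \<open>profit I i j k\<close> are the quantities \<open>a\<close> and \<open>w\<close> for resource (profit type) \<open>i\<close>,
  request type \<open>j\<close> and option \<open>k\<close>.
\<close>

definition valid_instance :: "allocation_instance \<Rightarrow> bool" where
  "valid_instance I \<longleftrightarrow>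
     finite (types I) \<and> finite (options I) \<and> set_pmf (type_pmf I) \<subseteq> types I \<and>
     (\<forall>i<num_resources I. capacity I i > 0) \<and>
     (\<forall>i<num_resources I. \<forall>j\<in>types I. \<forall>k\<in>options I.
        consumption I i j k \<ge> 0 \<and> profit I i j k \<ge> 0)"

definition expected_LP_feasible ::
    "allocation_instance \<Rightarrow> (nat \<Rightarrow> nat \<Rightarrow> real) \<Rightarrow> real \<Rightarrow> bool" where
  "expected_LP_feasible I x l \<longleftrightarrow>
     (\<forall>i<num_resources I.
        (\<Sum>j\<in>types I. \<Sum>k\<in>options I.
           real (num_requests I) * pmf (type_pmf I) j * profit I i j k * x j k) \<ge> l) \<and>
     (\<forall>i<num_resources I.
        (\<Sum>j\<in>types I. \<Sum>k\<in>options I.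
           real (num_requests I) * pmf (type_pmf I) j * consumption I i j k * x j k)
          \<le> capacity I i) \<and>
     (\<forall>j\<in>types I. (\<Sum>k\<in>options I. x j k) \<le> 1) \<and>
     (\<forall>j\<in>types I. \<forall>k\<in>options I. x j k \<ge> 0)"

definition W_E :: "allocation_instance \<Rightarrow> real" where
  "W_E I = Sup {l. \<exists>x. expected_LP_feasible I x l}"

definition gamma_param :: "allocation_instance \<Rightarrow> real" where
  "gamma_param I = Max
     ({consumption I i j k / capacity I i | i j k.
         i < num_resources I \<and> j \<in> types I \<and> k \<in> options I} \<union>
      {profit I i j k / W_E I | i j k.
         i < num_resources I \<and> j \<in> types I \<and> k \<in> options I})"

text \<open>
  A history lists the requests seen so far, each with the decision taken for it:
  \<open>None\<close> drops the request, \<open>Some k\<close> serves it with option \<open>k\<close>. A (possibly randomized)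
  policy maps the history and the type of the current request to a distribution over
  decisions; in particular it may depend on the number of requests already seen.
\<close>

type_synonym history = "(nat \<times> nat option) list"
type_synonym policy = "history \<Rightarrow> nat \<Rightarrow> nat option pmf"

primrec run :: "allocation_instance \<Rightarrow> policy \<Rightarrow> nat \<Rightarrow> history pmf" where
  "run I A 0 = return_pmf []"
| "run I A (Suc t) =
     bind_pmf (run I A t) (\<lambda>h.
       bind_pmf (type_pmf I) (\<lambda>j.
         map_pmf (\<lambda>d. h @ [(j, d)]) (A h j)))"

definition total :: "(nat \<Rightarrow> nat \<Rightarrow> real) \<Rightarrow> history \<Rightarrow> real" where
  "total q h = (\<Sum>(j, d)\<leftarrow>h. case d of None \<Rightarrow> 0 | Some k \<Rightarrow> q j k)"

text \<open>
  An online algorithm uses only the available options and respects the capacities on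
  every outcome of positive probability.
\<close>

definition online_algorithm :: "allocation_instance \<Rightarrow> policy \<Rightarrow> bool" where
  "online_algorithm I A \<longleftrightarrow>
     (\<forall>h\<in>set_pmf (run I A (num_requests I)).
        (\<forall>(j, d)\<in>set h. d \<in> insert None (Some ` options I)) \<and>
        (\<forall>i<num_resources I. total (consumption I i) h \<le> capacity I i))"

definition objective :: "allocation_instance \<Rightarrow> history \<Rightarrow> real" where
  "objective I h = (MIN i\<in>{..<num_resources I}. total (profit I i) h)"

definition approx_factor :: "allocation_instance \<Rightarrow> policy \<Rightarrow> real" where
  "approx_factor I A =
     measure_pmf.expectation (run I A (num_requests I)) (objective I) / W_E I"

end

theory Submission
  imports Defs
begin

text \<open>
  Every request yields, independently for each profit type, the profit \<open>(1 \<plusminus> \<delta>) / m\<close> with a uniform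
  sign; nothing is consumed, so serving everything is optimal and \<open>W\<^sub>E = 1\<close>. The total type-\<open>i\<close>
  profit is then \<open>1 + \<delta> S\<^sub>i / m\<close> for independent sums \<open>S\<^sub>i\<close> of \<open>m \<approx> 2 ln n / \<epsilon>\<^sup>2\<close> signs. Cut such a sum
  into about \<open>ln n\<close> blocks: by the Paley-Zygmund inequality each block is at most minus half its
  standard deviation with constant probability, so with probability of order \<open>1 / n\<close> the whole sum is
  at most \<open>- c \<epsilon> m\<close>. Hence with constant probability one of \<open>S\<^sub>1, \<dots>, S\<^sub>n\<^sub>-\<^sub>1\<close> is that small, while
  the independent \<open>S\<^sub>0\<close> has mean zero on the complement; the expected minimum loses the order of \<open>\<epsilon>\<close>.
\<close>

section \<open>The Paley-Zygmund inequality and expected minima\<close>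

lemma two_mult_diff_le_square_add_of_bool:
  fixes a c x :: real
  assumes "0 \<le> a" "0 \<le> c"
  shows "2 * a * (x - c) \<le> a\<^sup>2 * x\<^sup>2 + of_bool (c < x)"
proof (cases "c < x")
  case True
  have "2 * a * (x - c) \<le> 2 * a * x"
    using assms by (intro mult_left_mono) auto
  also have "\<dots> \<le> (a * x)\<^sup>2 + 1"
    using sum_squares_bound[of "a * x" 1] by simp
  finally show ?thesis using True by (simp add: power_mult_distrib)
next
  case False
  then have "2 * a * (x - c) \<le> 0"
    using assms by (intro mult_nonneg_nonpos) auto
  also have "0 \<le> a\<^sup>2 * x\<^sup>2 + of_bool (c < x)" by simp
  finally show ?thesis .
qed

lemma (in prob_space) Paley_Zygmund_inequality:
  fixes X :: "'a \<Rightarrow> real"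
  assumes [simp]: "integrable M X" "integrable M (\<lambda>x. (X x)\<^sup>2)"
    and "0 \<le> \<theta>" "\<theta> \<le> 1" "0 \<le> expectation X"
  shows "(1 - \<theta>)\<^sup>2 * (expectation X)\<^sup>2
    \<le> prob {x \<in> space M. \<theta> * expectation X < X x} * expectation (\<lambda>x. (X x)\<^sup>2)"
proof (cases "expectation (\<lambda>x. (X x)\<^sup>2) = 0")
  case True
  then have "(expectation X)\<^sup>2 \<le> 0"
    using variance_positive[of X] by (simp add: variance_eq)
  with True show ?thesis by simp
next
  case False
  define \<mu> N where "\<mu> = expectation X" and "N = expectation (\<lambda>x. (X x)\<^sup>2)"
  define E where "E = {x \<in> space M. \<theta> * \<mu> < X x}"
  define c a where "c = (1 - \<theta>) * \<mu>" and "a = c / N"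
  have "N > 0" using False by (simp add: N_def less_le)
  have "a \<ge> 0" and "\<mu> \<ge> 0" using assms \<open>N > 0\<close> by (simp_all add: a_def c_def \<mu>_def)
  have [measurable]: "X \<in> borel_measurable M" by (rule borel_measurable_integrable) simp
  have [measurable]: "E \<in> events" unfolding E_def by measurable
  have pointwise: "2 * a * (X x - \<theta> * \<mu>) \<le> a\<^sup>2 * (X x)\<^sup>2 + indicator E x" if "x \<in> space M" for x
    using two_mult_diff_le_square_add_of_bool[of a "\<theta> * \<mu>" "X x"] that \<open>a \<ge> 0\<close> \<open>\<mu> \<ge> 0\<close> assms(3)
    by (simp add: E_def indicator_def)
  have "2 * a * c = expectation (\<lambda>x. 2 * a * (X x - \<theta> * \<mu>))"
    by (simp add: c_def \<mu>_def prob_space algebra_simps)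
  also have "\<dots> \<le> expectation (\<lambda>x. a\<^sup>2 * (X x)\<^sup>2 + indicator E x)"
    by (intro integral_mono pointwise) (auto simp: less_top[symmetric])
  also have "\<dots> = a\<^sup>2 * N + prob E"
    by (simp add: N_def less_top[symmetric])
  finally have "N * (2 * a * c) \<le> N * (a\<^sup>2 * N + prob E)"
    using \<open>N > 0\<close> by simp
  moreover have "c = a * N"
    using \<open>N > 0\<close> by (simp add: a_def)
  ultimately have "c\<^sup>2 \<le> prob E * N"
    by (simp add: power2_eq_square algebra_simps)
  then show ?thesis
    by (simp add: c_def power_mult_distrib E_def \<mu>_def N_def)
qed

lemma expectation_bind_pmf_finite:
  fixes h :: "'b \<Rightarrow> real"
  assumes "finite (set_pmf p)" "\<And>x. x \<in> set_pmf p \<Longrightarrow> finite (set_pmf (f x))"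
  shows "measure_pmf.expectation (bind_pmf p f) h =
    measure_pmf.expectation p (\<lambda>x. measure_pmf.expectation (f x) h)"
  by (subst pmf_expectation_bind[OF assms(1)])
    (simp_all add: assms integral_measure_pmf_real[OF assms(1)] mult.commute)

lemma Min_image_insert_le_indicator:
  fixes y :: "'i \<Rightarrow> real"
  assumes "finite A"
  shows "(MIN i\<in>insert a A. y i) \<le> s + (y a - s) * indicator (Pi A (\<lambda>_. {s<..})) y"
proof (cases "y \<in> Pi A (\<lambda>_. {s<..})")
  case True
  with assms show ?thesis by simp
next
  case False
  then obtain i where "i \<in> A" "y i \<le> s" by (auto simp: Pi_iff not_less)
  then have "(MIN i\<in>insert a A. y i) \<le> s"
    using assms by (intro order_trans[OF Min_le[of _ "y i"]]) auto
  then show ?thesis using False by simp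
qed

lemma expectation_Min_Pi_pmf_le:
  fixes p :: "'i \<Rightarrow> real pmf"
  assumes "finite A" "a \<notin> A"
    and finite_support: "\<And>i. i \<in> insert a A \<Longrightarrow> finite (set_pmf (p i))"
  shows "measure_pmf.expectation (Pi_pmf (insert a A) d p) (\<lambda>y. MIN i\<in>insert a A. y i)
    \<le> s + (measure_pmf.expectation (p a) (\<lambda>x. x) - s) * (\<Prod>i\<in>A. measure_pmf.prob (p i) {s<..})"
proof -
  let ?S = "Pi A (\<lambda>_. {s<..})"
  have finite_Pi: "finite (set_pmf (Pi_pmf A d p))" "finite (set_pmf (Pi_pmf (insert a A) d p))"
    using assms by (auto simp: set_Pi_pmf)
  have "measure_pmf.expectation (Pi_pmf (insert a A) d p) (\<lambda>y. MIN i\<in>insert a A. y i)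
    \<le> measure_pmf.expectation (Pi_pmf (insert a A) d p) (\<lambda>y. s + (y a - s) * indicator ?S y)"
    by (intro integral_mono integrable_measure_pmf_finite finite_Pi Min_image_insert_le_indicator
        \<open>finite A\<close>)
  also have "\<dots> = measure_pmf.expectation (p a) (\<lambda>x. measure_pmf.expectation (Pi_pmf A d p)
      (\<lambda>y. s + (x - s) * indicator ?S y))"
  proof -
    have "indicator ?S (y(a := x)) = (indicator ?S y :: real)" for x y
      using \<open>a \<notin> A\<close> by (auto simp: indicator_def Pi_iff)
    then show ?thesis
      using assms finite_Pi by (simp add: Pi_pmf_insert' expectation_bind_pmf_finite)
  qed
  also have "\<dots> = measure_pmf.expectation (p a)
      (\<lambda>x. s + (x - s) * (\<Prod>i\<in>A. measure_pmf.prob (p i) {s<..}))"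
    using finite_Pi \<open>finite A\<close> by (simp add: integrable_measure_pmf_finite measure_Pi_pmf_Pi)
  also have "\<dots> = s + (measure_pmf.expectation (p a) (\<lambda>x. x) - s) *
      (\<Prod>i\<in>A. measure_pmf.prob (p i) {s<..})"
    using finite_support by (simp add: integrable_measure_pmf_finite)
  finally show ?thesis .
qed

section \<open>Sums of independent identically distributed variables\<close>

lemma map_replicate_pmf: "map_pmf (map f) (replicate_pmf t p) = replicate_pmf t (map_pmf f p)"
proof (induction t)
  case (Suc t)
  have "map_pmf (map f) (replicate_pmf (Suc t) p) =
      bind_pmf p (\<lambda>x. map_pmf ((#) (f x)) (map_pmf (map f) (replicate_pmf t p)))"
    by (simp add: map_bind_pmf pmf.map_comp o_def flip: map_pmf_def)
  then show ?case
    by (simp add: Suc bind_map_pmf flip: map_pmf_def)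
qed simp

definition iid_sum :: "nat \<Rightarrow> 'a::monoid_add pmf \<Rightarrow> 'a pmf" where
  "iid_sum t p = map_pmf sum_list (replicate_pmf t p)"

lemma iid_sum_0 [simp]: "iid_sum 0 p = return_pmf 0"
  by (simp add: iid_sum_def)

lemma iid_sum_Suc: "iid_sum (Suc t) p = bind_pmf p (\<lambda>x. map_pmf ((+) x) (iid_sum t p))"
  by (simp add: iid_sum_def map_bind_pmf pmf.map_comp o_def flip: map_pmf_def)

lemma iid_sum_add:
  "iid_sum (a + b) p = map_pmf (\<lambda>(x, y). x + y) (pair_pmf (iid_sum a p) (iid_sum b p))"
  by (simp add: iid_sum_def replicate_pmf_distrib map_pmf_def pair_pmf_def bind_assoc_pmf
      bind_return_pmf)

lemma finite_set_pmf_iid_sum: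
  "finite (set_pmf p) \<Longrightarrow> finite (set_pmf (iid_sum t p))"
  by (induction t) (simp_all add: iid_sum_Suc)

lemma iid_sum_map_affine:
  fixes p :: "real pmf"
  shows "iid_sum t (map_pmf (\<lambda>x. a + b * x) p) = map_pmf (\<lambda>x. real t * a + b * x) (iid_sum t p)"
proof -
  have "sum_list (map (\<lambda>x. a + b * x) xs) = real t * a + b * sum_list xs"
    if "xs \<in> set_pmf (replicate_pmf t p)" for xs
    using that by (simp add: set_replicate_pmf sum_list_addf sum_list_const_mult sum_list_triv)
  then show ?thesis
    unfolding iid_sum_def map_replicate_pmf[symmetric] pmf.map_comp
    by (intro map_pmf_cong) auto
qed

lemma map_sum_replicate_Pi_pmf:
  fixes p :: "'i \<Rightarrow> 'a::monoid_add pmf"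
  assumes "finite A"
  shows "map_pmf (\<lambda>ys i. \<Sum>y\<leftarrow>ys. y i) (replicate_pmf t (Pi_pmf A 0 p)) =
    Pi_pmf A 0 (\<lambda>i. iid_sum t (p i))"
proof (induction t)
  case 0
  show ?case using assms by simp
next
  case (Suc t)
  have "map_pmf (\<lambda>ys i. \<Sum>y\<leftarrow>ys. y i) (replicate_pmf (Suc t) (Pi_pmf A 0 p)) =
      bind_pmf (Pi_pmf A 0 p) (\<lambda>x. map_pmf (\<lambda>y i. x i + y i)
        (map_pmf (\<lambda>ys i. \<Sum>y\<leftarrow>ys. y i) (replicate_pmf t (Pi_pmf A 0 p))))"
    by (simp add: map_bind_pmf pmf.map_comp o_def flip: map_pmf_def)
  also have "\<dots> = bind_pmf (Pi_pmf A 0 p)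
      (\<lambda>x. map_pmf (\<lambda>y i. x i + y i) (Pi_pmf A 0 (\<lambda>i. iid_sum t (p i))))"
    by (simp only: Suc)
  also have "\<dots> = bind_pmf (Pi_pmf A 0 p)
      (\<lambda>x. Pi_pmf A 0 (\<lambda>i. map_pmf ((+) (x i)) (iid_sum t (p i))))"
  proof (intro bind_pmf_cong refl)
    fix x assume "x \<in> set_pmf (Pi_pmf A 0 p)"
    then have "x i = 0" if "i \<notin> A" for i
      using that assms by (auto simp: set_Pi_pmf PiE_dflt_def)
    then show "map_pmf (\<lambda>y i. x i + y i) (Pi_pmf A 0 (\<lambda>i. iid_sum t (p i))) =
        Pi_pmf A 0 (\<lambda>i. map_pmf ((+) (x i)) (iid_sum t (p i)))"
      unfolding map_pmf_def using assms
      by (subst Pi_pmf_bind[where d' = 0])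
        (auto intro!: bind_pmf_cong simp: set_Pi_pmf PiE_dflt_def fun_eq_iff)
  qed
  also have "\<dots> = Pi_pmf A 0 (\<lambda>i. iid_sum (Suc t) (p i))"
    unfolding iid_sum_Suc using assms by (rule Pi_pmf_bind[symmetric])
  finally show ?case .
qed

lemma expectation_iid_sum_Suc:
  fixes f :: "'a::monoid_add \<Rightarrow> real"
  assumes "finite (set_pmf p)"
  shows "measure_pmf.expectation (iid_sum (Suc t) p) f =
    measure_pmf.expectation p (\<lambda>x. measure_pmf.expectation (iid_sum t p) (\<lambda>y. f (x + y)))"
  by (simp add: iid_sum_Suc expectation_bind_pmf_finite finite_set_pmf_iid_sum assms)

lemma integrable_iid_sum:
  fixes f :: "'a::monoid_add \<Rightarrow> real"
  shows "finite (set_pmf p) \<Longrightarrow> integrable (iid_sum t p) f"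
  by (intro integrable_measure_pmf_finite finite_set_pmf_iid_sum)

lemma expectation_iid_sum:
  fixes p :: "real pmf"
  assumes "finite (set_pmf p)"
  shows "measure_pmf.expectation (iid_sum t p) (\<lambda>x. x) = real t * measure_pmf.expectation p (\<lambda>x. x)"
  using assms by (induction t)
    (simp_all add: expectation_iid_sum_Suc integrable_iid_sum integrable_measure_pmf_finite algebra_simps)

definition moment :: "nat \<Rightarrow> real pmf \<Rightarrow> real" where
  "moment k p = measure_pmf.expectation p (\<lambda>x. x ^ k)"

lemma second_moment_iid_sum:
  assumes "finite (set_pmf p)" "measure_pmf.expectation p (\<lambda>x. x) = 0"
  shows "moment 2 (iid_sum t p) = real t * moment 2 p"
proof (induction t)
  case (Suc t)
  have "moment 2 (iid_sum (Suc t) p) = moment 2 p + moment 2 (iid_sum t p)"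
    unfolding moment_def using assms
    by (simp add: expectation_iid_sum_Suc power2_sum expectation_iid_sum integrable_iid_sum
        integrable_measure_pmf_finite)
  with Suc show ?case by (simp add: algebra_simps)
qed (simp add: moment_def)

lemma fourth_moment_iid_sum:
  assumes "finite (set_pmf p)" "measure_pmf.expectation p (\<lambda>x. x) = 0"
  shows "moment 4 (iid_sum t p) = real t * moment 4 p + 3 * real t * (real t - 1) * (moment 2 p)\<^sup>2"
proof (induction t)
  case (Suc t)
  have binomial: "(x + y) ^ 4 = x ^ 4 + 4 * x ^ 3 * y + 6 * x\<^sup>2 * y\<^sup>2 + 4 * x * y ^ 3 + y ^ 4"
    for x y :: real
    by (simp add: eval_nat_numeral algebra_simps)
  have "moment 4 (iid_sum (Suc t) p) =
      moment 4 p + 6 * (moment 2 p * moment 2 (iid_sum t p)) + moment 4 (iid_sum t p)"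
    using assms
    by (simp add: expectation_iid_sum_Suc binomial expectation_iid_sum integrable_iid_sum
        integrable_measure_pmf_finite moment_def)
  with Suc assms show ?case
    by (simp add: second_moment_iid_sum algebra_simps power2_eq_square)
qed (simp add: moment_def)

section \<open>Lower tails\<close>

lemma prob_pair_pmf_Times:
  "measure_pmf.prob (pair_pmf p q) (A \<times> B) = measure_pmf.prob p A * measure_pmf.prob q B"
proof -
  have "measure_pmf.prob (pair_pmf p q) (A \<times> B) =
      measure_pmf.prob (pair_pmf p q) ((A \<inter> set_pmf p) \<times> (B \<inter> set_pmf q))"
    by (subst measure_Int_set_pmf[symmetric]) (simp add: Times_Int_Times)
  then show ?thesis
    by (simp add: measure_pmf_prob_product measure_Int_set_pmf)
qed

lemma cdf_iid_sum_add:
  "cdf (iid_sum a p) x * cdf (iid_sum b p) y \<le> cdf (iid_sum (a + b) p) (x + y)"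
proof -
  let ?P = "pair_pmf (iid_sum a p) (iid_sum b p)"
  have "cdf (iid_sum a p) x * cdf (iid_sum b p) y = measure_pmf.prob ?P ({..x} \<times> {..y})"
    by (simp add: cdf_def2 prob_pair_pmf_Times)
  also have "\<dots> \<le> measure_pmf.prob ?P ((\<lambda>(x, y). x + y) -` {..x + y})"
    by (rule measure_pmf.finite_measure_mono) auto
  finally show ?thesis by (simp add: iid_sum_add cdf_def2)
qed

lemma cdf_iid_sum_blocks:
  "cdf (iid_sum b p) x ^ l * cdf (iid_sum r p) y \<le> cdf (iid_sum (l * b + r) p) (real l * x + y)"
proof (induction l)
  case (Suc l)
  have "cdf (iid_sum b p) x ^ Suc l * cdf (iid_sum r p) y
      \<le> cdf (iid_sum b p) x * cdf (iid_sum (l * b + r) p) (real l * x + y)"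
    using mult_left_mono[OF Suc, of "cdf (iid_sum b p) x"] by (simp add: cdf_def2 mult.assoc)
  also have "\<dots> \<le> cdf (iid_sum (b + (l * b + r)) p) (x + (real l * x + y))"
    by (rule cdf_iid_sum_add)
  finally show ?case by (simp add: algebra_simps)
qed simp

lemma one_minus_power_ge:
  fixes p :: real
  assumes "p \<le> 1" "0 \<le> x" "x \<le> real k * p"
  shows "x / (1 + x) \<le> 1 - (1 - p) ^ k"
proof -
  have "(1 - p) ^ k \<le> exp (- p) ^ k"
    using assms exp_ge_add_one_self[of "- p"] by (intro power_mono) auto
  also have "\<dots> = exp (- (real k * p))"
    by (simp flip: exp_of_nat_mult)
  also have "\<dots> \<le> exp (- x)" using assms by simp
  also have "\<dots> \<le> 1 / (1 + x)"
    using exp_ge_add_one_self[of x] assms by (simp add: exp_minus field_simps)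
  finally show ?thesis using assms by (simp add: field_simps)
qed

lemma prob_abs_ge_symmetric_le:
  fixes p :: "real pmf"
  assumes "map_pmf uminus p = p"
  shows "measure_pmf.prob p {y. x \<le> \<bar>y\<bar>} \<le> 2 * cdf p (- x)"
proof -
  have "measure_pmf.prob p {y. x \<le> \<bar>y\<bar>} \<le> measure_pmf.prob p ({..- x} \<union> uminus -` {..- x})"
    by (rule measure_pmf.finite_measure_mono) auto
  also have "\<dots> \<le> measure_pmf.prob p {..- x} + measure_pmf.prob p (uminus -` {..- x})"
    by (rule measure_Un_le) auto
  also have "measure_pmf.prob p (uminus -` {..- x}) = cdf (map_pmf uminus p) (- x)"
    by (simp add: cdf_def2)
  finally show ?thesis by (simp add: assms cdf_def2)
qed

locale symmetric_platykurtic_pmf =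
  fixes p :: "real pmf"
  assumes finite_support: "finite (set_pmf p)"
    and symmetric: "map_pmf uminus p = p"
    and second_moment_pos: "0 < moment 2 p"
    and fourth_moment_le: "moment 4 p \<le> 3 * (moment 2 p)\<^sup>2"
begin

lemma mean_zero: "measure_pmf.expectation p (\<lambda>x. x) = 0"
proof -
  have "measure_pmf.expectation p (\<lambda>x. x) = measure_pmf.expectation (map_pmf uminus p) (\<lambda>x. x)"
    by (simp only: symmetric)
  then show ?thesis by simp
qed

lemma symmetric_iid_sum: "map_pmf uminus (iid_sum t p) = iid_sum t p"
  using iid_sum_map_affine[of t 0 "- 1" p] by (simp add: symmetric)

lemma cdf_iid_sum_zero_ge: "1 / 2 \<le> cdf (iid_sum t p) 0"
  using prob_abs_ge_symmetric_le[OF symmetric_iid_sum[of t], where x = 0] by simp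

lemma fourth_moment_iid_sum_le:
  "moment 4 (iid_sum t p) \<le> 3 * (real t * moment 2 p)\<^sup>2"
proof -
  have "moment 4 (iid_sum t p) = real t * moment 4 p + 3 * real t * (real t - 1) * (moment 2 p)\<^sup>2"
    by (simp add: fourth_moment_iid_sum finite_support mean_zero)
  also have "\<dots> \<le> real t * (3 * (moment 2 p)\<^sup>2) + 3 * real t * (real t - 1) * (moment 2 p)\<^sup>2"
    using fourth_moment_le by (intro add_right_mono mult_left_mono) simp_all
  finally show ?thesis by (simp add: power2_eq_square algebra_simps)
qed

lemma cdf_iid_sum_half_deviation_ge:
  assumes "0 < t"
  shows "3 / 32 \<le> cdf (iid_sum t p) (- (sqrt (real t * moment 2 p) / 2))"
proof -
  let ?S = "iid_sum t p" and ?v = "real t * moment 2 p"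
  let ?P = "measure_pmf.prob ?S {x. ?v / 4 < x\<^sup>2}"
  have variance_pos: "0 < ?v" using assms second_moment_pos by simp
  have mean_square: "measure_pmf.expectation ?S (\<lambda>x. x\<^sup>2) = ?v"
    using second_moment_iid_sum[of p t]
    by (simp add: finite_support mean_zero moment_def)
  have "(1 - 1 / 4)\<^sup>2 * ?v\<^sup>2 \<le> ?P * moment 4 ?S"
    using measure_pmf.Paley_Zygmund_inequality[of ?S "\<lambda>x. x\<^sup>2" "1 / 4"] variance_pos
    by (simp add: integrable_iid_sum finite_support mean_square moment_def[of 4] del: power_divide)
  also have "\<dots> \<le> ?P * (3 * ?v\<^sup>2)"
    by (intro mult_left_mono fourth_moment_iid_sum_le) simp
  finally have "3 / 16 * (3 * ?v\<^sup>2) \<le> ?P * (3 * ?v\<^sup>2)"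
    by (simp add: power_divide)
  then have "3 / 16 \<le> ?P"
    by (rule mult_right_le_imp_le) (intro mult_pos_pos zero_less_power variance_pos, simp)
  also have "?P \<le> measure_pmf.prob ?S {x. sqrt ?v / 2 \<le> \<bar>x\<bar>}"
  proof (rule measure_pmf.finite_measure_mono)
    have "sqrt ?v / 2 \<le> \<bar>x\<bar>" if "?v / 4 < x\<^sup>2" for x
      using real_sqrt_le_mono[OF less_imp_le[OF that]] by (simp add: real_sqrt_divide)
    then show "{x. ?v / 4 < x\<^sup>2} \<subseteq> {x. sqrt ?v / 2 \<le> \<bar>x\<bar>}" by auto
  qed simp
  also have "\<dots> \<le> 2 * cdf ?S (- (sqrt ?v / 2))"
    by (rule prob_abs_ge_symmetric_le[OF symmetric_iid_sum])
  finally show ?thesis by simp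
qed

lemma cdf_iid_sum_block_deviations_ge:
  assumes "0 < b"
  shows "exp (- 3 * real l) / 2
    \<le> cdf (iid_sum (l * b + r) p) (- (real l * (sqrt (real b * moment 2 p) / 2)))"
proof -
  let ?x = "- (sqrt (real b * moment 2 p) / 2)"
  have "(5 / 2 :: real) ^ 3 \<le> exp 1 ^ 3"
    using exp_lower_Taylor_quadratic[of 1] by (intro power_mono) auto
  then have "32 / 3 \<le> exp (3 :: real)"
    by (simp add: power_divide flip: exp_of_nat_mult)
  then have "exp (- 3) \<le> (3 / 32 :: real)"
    by (simp add: exp_minus field_simps)
  also have "\<dots> \<le> cdf (iid_sum b p) ?x"
    by (rule cdf_iid_sum_half_deviation_ge[OF assms])
  finally have "exp (- 3) ^ l * (1 / 2) \<le> cdf (iid_sum b p) ?x ^ l * cdf (iid_sum r p) 0"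
    using cdf_iid_sum_zero_ge by (intro mult_mono power_mono) (simp_all add: cdf_def2)
  also have "\<dots> \<le> cdf (iid_sum (l * b + r) p) (real l * ?x + 0)"
    by (rule cdf_iid_sum_blocks)
  finally show ?thesis by (simp add: mult.commute flip: exp_of_nat_mult)
qed

lemma cdf_iid_sum_ge_exp_blocks:
  assumes "0 < l" "l \<le> t" and s_le: "8 * s\<^sup>2 \<le> real l * (real t * moment 2 p)"
  shows "exp (- 3 * real l) / 2 \<le> cdf (iid_sum t p) (- s)"
proof -
  define b where "b = t div l"
  let ?d = "real l * (sqrt (real b * moment 2 p) / 2)"
  have "0 \<le> moment 2 p" using second_moment_pos by simp
  have "0 < b" using assms by (simp add: b_def div_greater_zero_iff)
  have t_split: "t = l * b + t mod l" by (simp add: b_def)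
  have "t mod l \<le> l" using assms by (simp add: less_imp_le)
  also have "l \<le> l * b" using \<open>0 < b\<close> by simp
  finally have "t \<le> 2 * (l * b)" using t_split by linarith
  then have "real t \<le> 2 * (real l * real b)"
    by (metis of_nat_le_iff of_nat_mult of_nat_numeral)
  then have "real l * (real t * moment 2 p) \<le> real l * (2 * (real l * real b) * moment 2 p)"
    using \<open>0 \<le> moment 2 p\<close> by (intro mult_left_mono mult_right_mono) simp_all
  with s_le have "s\<^sup>2 \<le> ?d\<^sup>2"
    using \<open>0 \<le> moment 2 p\<close>
    by (simp add: power_mult_distrib power_divide power2_eq_square mult_ac)
  then have "s \<le> ?d"
    by (rule power2_le_imp_le) (simp add: \<open>0 \<le> moment 2 p\<close>)
  have "exp (- 3 * real l) / 2 \<le> cdf (iid_sum t p) (- ?d)"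
    using cdf_iid_sum_block_deviations_ge[OF \<open>0 < b\<close>, of l "t mod l", folded t_split] .
  also have "\<dots> \<le> cdf (iid_sum t p) (- s)"
    unfolding cdf_def2 using \<open>s \<le> ?d\<close> by (intro measure_pmf.finite_measure_mono) auto
  finally show ?thesis .
qed

lemma cdf_iid_sum_ge_exp:
  assumes "0 < s" and s_le: "8 * s\<^sup>2 \<le> (real t)\<^sup>2 * moment 2 p"
  shows "exp (- 24 * s\<^sup>2 / (real t * moment 2 p) - 3) / 2 \<le> cdf (iid_sum t p) (- s)"
proof -
  define v where "v = real t * moment 2 p"
  define l where "l = nat \<lceil>8 * s\<^sup>2 / v\<rceil>"
  have "t \<noteq> 0" using assms by (auto intro: gr0I)
  then have "0 < v" using second_moment_pos by (simp add: v_def)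
  then have "0 < 8 * s\<^sup>2 / v" using \<open>0 < s\<close> by simp
  then have l_bounds: "8 * s\<^sup>2 / v \<le> real l" "real l < 8 * s\<^sup>2 / v + 1" "0 < l"
    unfolding l_def by linarith+
  have "8 * s\<^sup>2 / v \<le> real t"
    using s_le \<open>0 < v\<close> by (simp add: v_def divide_le_eq power2_eq_square mult_ac)
  then have "l \<le> t" by (simp add: l_def nat_le_iff ceiling_le_iff)
  moreover have "8 * s\<^sup>2 \<le> real l * v"
    using l_bounds(1) \<open>0 < v\<close> by (simp add: divide_le_eq)
  moreover have "exp (- 24 * s\<^sup>2 / v - 3) / 2 \<le> exp (- 3 * real l) / 2"
    using l_bounds(2) by simp
  ultimately show ?thesis
    using cdf_iid_sum_ge_exp_blocks[OF l_bounds(3), of t s] by (simp only: v_def order_trans)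
qed

lemma cdf_iid_sum_ge_inverse:
  assumes "1 < x" "ln x \<le> 3 * real t"
  shows "1 / (54 * x) \<le> cdf (iid_sum t p) (- sqrt (real t * moment 2 p * ln x / 24))"
proof -
  let ?v = "real t * moment 2 p"
  let ?s = "sqrt (?v * ln x / 24)"
  have ln_pos: "0 < ln x" using assms by simp
  then have "0 < t" using assms by (auto intro: gr0I)
  then have variance_pos: "0 < ?v" using second_moment_pos by simp
  have s_square: "?s\<^sup>2 = ?v * ln x / 24"
    using ln_pos variance_pos by simp
  have "exp 1 ^ 3 \<le> (3 :: real) ^ 3"
    using exp_le by (intro power_mono) auto
  then have "exp (3 :: real) \<le> 27"
    by (simp flip: exp_of_nat_mult)
  then have "1 / (54 * x) \<le> 1 / (x * exp 3) / 2"
    using assms by (simp add: field_simps)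
  also have "1 / (x * exp 3) = exp (- ln x - 3)"
    using assms by (simp add: exp_diff exp_minus field_simps)
  also have "- ln x = - 24 * ?s\<^sup>2 / ?v"
    unfolding s_square using second_moment_pos \<open>0 < t\<close> by simp
  also have "exp (- 24 * ?s\<^sup>2 / ?v - 3) / 2 \<le> cdf (iid_sum t p) (- ?s)"
  proof (rule cdf_iid_sum_ge_exp)
    show "0 < ?s" using ln_pos variance_pos by simp
    show "8 * ?s\<^sup>2 \<le> (real t)\<^sup>2 * moment 2 p"
      unfolding s_square using mult_left_mono[OF assms(2), of ?v] variance_pos
      by (simp add: power2_eq_square mult_ac)
  qed
  finally show ?thesis .
qed

lemma one_minus_cdf_iid_sum_power_ge:
  assumes "n \<ge> 2" "ln (real n) \<le> 3 * real t"
  shows "1 / 109 \<le>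
    1 - (1 - cdf (iid_sum t p) (- sqrt (real t * moment 2 p * ln (real n) / 24))) ^ (n - 1)"
    (is "_ \<le> 1 - (1 - ?p) ^ _")
proof -
  have "1 / 108 \<le> real (n - 1) * (1 / (54 * real n))"
    using assms by (simp add: field_simps of_nat_diff)
  also have "\<dots> \<le> real (n - 1) * ?p"
    using assms by (intro mult_left_mono cdf_iid_sum_ge_inverse) auto
  finally have expected_count: "1 / 108 \<le> real (n - 1) * ?p" .
  have "1 / 108 / (1 + 1 / 108) \<le> 1 - (1 - ?p) ^ (n - 1)"
    by (rule one_minus_power_ge[OF _ _ expected_count]) (simp_all add: cdf_def2)
  then show ?thesis by simp
qed

end

section \<open>Instances with a single option\<close>

lemma map_fst_run: "map_pmf (map fst) (run I A t) = replicate_pmf t (type_pmf I)"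
proof (induction t)
  case (Suc t)
  have "map_pmf (map fst) (run I A (Suc t)) = bind_pmf (map_pmf (map fst) (run I A t))
      (\<lambda>js. map_pmf (\<lambda>j. js @ [j]) (type_pmf I))"
    by (simp add: map_bind_pmf bind_map_pmf pmf.map_comp o_def) (simp add: map_pmf_def)
  also have "\<dots> = replicate_pmf (t + 1) (type_pmf I)"
    unfolding Suc replicate_pmf_distrib
    by (simp add: map_pmf_def bind_assoc_pmf bind_return_pmf)
  finally show ?case by simp
qed simp

lemma set_pmf_runD:
  assumes "h \<in> set_pmf (run I A t)"
  shows "length h = t" "fst ` set h \<subseteq> set_pmf (type_pmf I)"
proof -
  have "map fst h \<in> set_pmf (replicate_pmf t (type_pmf I))"
    using assms by (simp flip: map_fst_run[of I A])
  then have "map fst h \<in> lists (set_pmf (type_pmf I))" "length h = t"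
    by (simp_all add: set_replicate_pmf)
  then show "length h = t" "fst ` set h \<subseteq> set_pmf (type_pmf I)"
    by (auto simp: in_lists_conv_set)
qed

lemma online_algorithm_set_subset:
  assumes "valid_instance I" "online_algorithm I A" "h \<in> set_pmf (run I A (num_requests I))"
  shows "set h \<subseteq> types I \<times> insert None (Some ` options I)"
  using assms set_pmf_runD(2)[OF assms(3)]
  unfolding valid_instance_def online_algorithm_def by fastforce

lemma finite_set_pmf_run:
  assumes "valid_instance I" "online_algorithm I A"
  shows "finite (set_pmf (run I A (num_requests I)))"
proof (rule finite_subset)
  let ?S = "types I \<times> insert None (Some ` options I)"
  show "set_pmf (run I A (num_requests I)) \<subseteq> {h. set h \<subseteq> ?S \<and> length h = num_requests I}"
    using online_algorithm_set_subset[OF assms] by (auto dest: set_pmf_runD(1))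
  show "finite {h. set h \<subseteq> ?S \<and> length h = num_requests I}"
    using assms(1) by (intro finite_lists_length_eq) (auto simp: valid_instance_def)
qed

lemma total_le_sum_list:
  assumes "set h \<subseteq> J \<times> {None, Some k}" "\<And>j. j \<in> J \<Longrightarrow> 0 \<le> q j k"
  shows "total q h \<le> (\<Sum>j\<leftarrow>map fst h. q j k)"
  using assms(1)
proof (induction h)
  case (Cons a h)
  then have "(case a of (j, d) \<Rightarrow> case d of None \<Rightarrow> 0 | Some k \<Rightarrow> q j k) \<le> q (fst a) k"
    using assms(2) by auto
  with Cons show ?case by (simp add: total_def add_mono)
qed (simp add: total_def)

lemma Min_image_mono:
  fixes f g :: "'a \<Rightarrow> 'b::linorder"
  assumes "finite A" "A \<noteq> {}" "\<And>i. i \<in> A \<Longrightarrow> f i \<le> g i"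
  shows "(MIN i\<in>A. f i) \<le> (MIN i\<in>A. g i)"
  using assms by (auto intro: order_trans[OF Min_le])

locale single_option_instance =
  fixes I :: allocation_instance and k :: nat
  assumes valid: "valid_instance I"
    and num_resources_pos: "0 < num_resources I"
    and options: "options I = {k}"
begin

lemma finite_types: "finite (types I)"
  and set_pmf_type_pmf_subset: "set_pmf (type_pmf I) \<subseteq> types I"
  using valid by (simp_all add: valid_instance_def)

lemma profit_nonneg: "i < num_resources I \<Longrightarrow> j \<in> types I \<Longrightarrow> 0 \<le> profit I i j k"
  using valid by (simp add: valid_instance_def options)

lemma expectation_objective_le:
  assumes online: "online_algorithm I A"
  shows "measure_pmf.expectation (run I A (num_requests I)) (objective I)
    \<le> measure_pmf.expectation (replicate_pmf (num_requests I) (type_pmf I))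
        (\<lambda>js. MIN i\<in>{..<num_resources I}. \<Sum>j\<leftarrow>js. profit I i j k)"
    (is "_ \<le> measure_pmf.expectation _ ?M")
proof -
  let ?R = "run I A (num_requests I)"
  have "objective I h \<le> ?M (map fst h)" if "h \<in> set_pmf ?R" for h
    unfolding objective_def
    using online_algorithm_set_subset[OF valid online that] num_resources_pos
    by (intro Min_image_mono total_le_sum_list[where J = "types I"])
      (auto simp: options profit_nonneg)
  then have "measure_pmf.expectation ?R (objective I)
      \<le> measure_pmf.expectation ?R (\<lambda>h. ?M (map fst h))"
    using finite_set_pmf_run[OF valid online]
    by (intro integral_mono_AE integrable_measure_pmf_finite AE_pmfI)
  also have "\<dots> = measure_pmf.expectation (map_pmf (map fst) ?R) ?M" by simp
  finally show ?thesis by (simp only: map_fst_run)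
qed

definition expected_total :: "(nat \<Rightarrow> nat \<Rightarrow> real) \<Rightarrow> real" where
  "expected_total q = real (num_requests I) * measure_pmf.expectation (type_pmf I) (\<lambda>j. q j k)"

lemma expected_total_eq_sum:
  "expected_total q = (\<Sum>j\<in>types I. real (num_requests I) * pmf (type_pmf I) j * q j k)"
  using finite_types set_pmf_type_pmf_subset unfolding expected_total_def
  by (subst integral_measure_pmf_real[of "types I"]) (auto simp: sum_distrib_left mult_ac)

lemma W_E_eq_Min_expected_total:
  assumes "\<And>i. i < num_resources I \<Longrightarrow> expected_total (consumption I i) \<le> capacity I i"
  shows "W_E I = (MIN i\<in>{..<num_resources I}. expected_total (profit I i))"
    (is "_ = ?W")
proof -
  have "l \<le> ?W" if feasible: "expected_LP_feasible I x l" for x l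
  proof -
    have "l \<le> expected_total (profit I i)" if "i < num_resources I" for i
    proof -
      have "l \<le> (\<Sum>j\<in>types I. real (num_requests I) * pmf (type_pmf I) j * profit I i j k * x j k)"
        using feasible that by (simp add: expected_LP_feasible_def options)
      also have "\<dots> \<le> expected_total (profit I i)"
        unfolding expected_total_eq_sum using feasible that
        by (intro sum_mono mult_left_le mult_nonneg_nonneg)
          (auto simp: expected_LP_feasible_def options profit_nonneg)
      finally show ?thesis .
    qed
    then show ?thesis using num_resources_pos by (subst Min_ge_iff) auto
  qed
  moreover have "expected_LP_feasible I (\<lambda>_ _. 1) ?W"
    using assms by (auto simp: expected_LP_feasible_def options expected_total_eq_sum)
  ultimately show ?thesis
    unfolding W_E_def by (intro cSup_eq_maximum) auto
qed

end

section \<open>Independent identically distributed profits\<close>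

text \<open>
  The request type \<open>j\<close> is a number encoding the vector \<open>from_nat_into (set_pmf P) j\<close> of the profits
  that the request yields.
\<close>

definition iid_profit_instance :: "nat \<Rightarrow> nat \<Rightarrow> real pmf \<Rightarrow> allocation_instance" where
  "iid_profit_instance n m q =
     (let P = Pi_pmf {..<n} 0 (\<lambda>_. q) in
       \<lparr>num_resources = n, num_requests = m,
        types = to_nat_on (set_pmf P) ` set_pmf P, options = {0},
        type_pmf = map_pmf (to_nat_on (set_pmf P)) P,
        capacity = (\<lambda>_. 1), consumption = (\<lambda>_ _ _. 0),
        profit = (\<lambda>i j k. from_nat_into (set_pmf P) j i)\<rparr>)"

lemma iid_profit_instance_simps [simp]:
  "num_resources (iid_profit_instance n m q) = n"
  "num_requests (iid_profit_instance n m q) = m"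
  "options (iid_profit_instance n m q) = {0}"
  "capacity (iid_profit_instance n m q) i = 1"
  "consumption (iid_profit_instance n m q) i j k = 0"
  by (simp_all add: iid_profit_instance_def Let_def)

lemma set_pmf_type_pmf_iid_profit_instance:
  "set_pmf (type_pmf (iid_profit_instance n m q)) = types (iid_profit_instance n m q)"
  by (simp add: iid_profit_instance_def Let_def)

lemma map_profit_type_pmf:
  "map_pmf (\<lambda>j i. profit (iid_profit_instance n m q) i j k) (type_pmf (iid_profit_instance n m q)) =
    Pi_pmf {..<n} 0 (\<lambda>_. q)"
proof -
  let ?P = "Pi_pmf {..<n} 0 (\<lambda>_. q) :: (nat \<Rightarrow> real) pmf"
  have "map_pmf (\<lambda>y. from_nat_into (set_pmf ?P) (to_nat_on (set_pmf ?P) y)) ?P = map_pmf (\<lambda>y. y) ?P"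
    by (intro map_pmf_cong refl) simp
  then show ?thesis
    by (simp add: iid_profit_instance_def Let_def pmf.map_comp o_def)
qed

lemma map_profit_type_pmf_component:
  assumes "i < n"
  shows "map_pmf (\<lambda>j. profit (iid_profit_instance n m q) i j k) (type_pmf (iid_profit_instance n m q)) = q"
  using arg_cong[OF map_profit_type_pmf[of n m q k], of "map_pmf (\<lambda>y. y i)"] assms
  by (simp add: pmf.map_comp o_def Pi_pmf_component)

lemma profit_image_types_iid_profit_instance:
  assumes "i < n"
  shows "(\<lambda>j. profit (iid_profit_instance n m q) i j k) ` types (iid_profit_instance n m q) = set_pmf q"
  by (metis map_profit_type_pmf_component[OF assms] set_map_pmf set_pmf_type_pmf_iid_profit_instance)

locale iid_profits =
  fixes n m :: nat and q :: "real pmf"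
  assumes n_pos: "0 < n"
    and finite_support: "finite (set_pmf q)"
    and nonneg_support: "set_pmf q \<subseteq> {0..}"
begin

abbreviation I :: allocation_instance where
  "I \<equiv> iid_profit_instance n m q"

sublocale single_option_instance I 0
proof
  have "finite (types I)"
    using finite_support by (auto simp: iid_profit_instance_def Let_def set_Pi_pmf)
  moreover have "0 \<le> profit I i j k" if "i < n" "j \<in> types I" for i j k
  proof -
    have "profit I i j k \<in> set_pmf q"
      unfolding profit_image_types_iid_profit_instance[OF that(1), of m q k, symmetric]
      using that(2) by (rule imageI)
    then show ?thesis using nonneg_support by auto
  qed
  ultimately show "valid_instance I"
    by (simp add: valid_instance_def set_pmf_type_pmf_iid_profit_instance)
qed (simp_all add: n_pos)

lemma W_E_eq: "W_E I = real m * measure_pmf.expectation q (\<lambda>x. x)"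
proof -
  have "expected_total (profit I i) = real m * measure_pmf.expectation q (\<lambda>x. x)"
    if "i < n" for i
    unfolding expected_total_def
    by (subst (2) map_profit_type_pmf_component[OF that, of m q 0, symmetric]) simp
  moreover have "W_E I = (MIN i\<in>{..<n}. expected_total (profit I i))"
    by (subst W_E_eq_Min_expected_total) (simp_all add: expected_total_def)
  ultimately show ?thesis
    using n_pos by (simp add: image_constant_conv lessThan_empty_iff cong: image_cong_simp)
qed

lemma W_E_nonneg: "0 \<le> W_E I"
  unfolding W_E_eq using nonneg_support
  by (intro mult_nonneg_nonneg Bochner_Integration.integral_nonneg_AE AE_pmfI) auto

lemma profit_ratios_eq:
  "{profit I i j k / w | i j k. i < n \<and> j \<in> types I \<and> k \<in> {0}} = (\<lambda>v. v / w) ` set_pmf q"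
proof -
  have "{profit I i j k / w | i j k. i < n \<and> j \<in> types I \<and> k \<in> {0}} =
      (\<Union>i\<in>{..<n}. (\<lambda>v. v / w) ` (\<lambda>j. profit I i j 0) ` types I)"
    by auto
  also have "\<dots> = (\<Union>i\<in>{..<n}. (\<lambda>v. v / w) ` set_pmf q)"
    by (intro SUP_cong) (simp_all add: profit_image_types_iid_profit_instance)
  finally show ?thesis using n_pos by auto
qed

lemma gamma_param_eq: "gamma_param I = Max (set_pmf q) / W_E I"
proof -
  have "types I \<noteq> {}"
    using set_pmf_not_empty[of "type_pmf I"] by (simp add: set_pmf_type_pmf_iid_profit_instance)
  then have "gamma_param I = Max ({0} \<union> (\<lambda>v. v / W_E I) ` set_pmf q)"
    unfolding gamma_param_def iid_profit_instance_simps profit_ratios_eq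
    using n_pos by (auto intro!: arg_cong[where f = Max])
  also have "\<dots> = Max (set_pmf q) / W_E I"
  proof (rule Max_eqI)
    have "0 \<le> Max (set_pmf q)"
      using finite_support nonneg_support set_pmf_not_empty[of q] by (auto simp: Max_ge_iff)
    then show "y \<le> Max (set_pmf q) / W_E I" if "y \<in> {0} \<union> (\<lambda>v. v / W_E I) ` set_pmf q" for y
      using that W_E_nonneg finite_support by (auto intro: divide_right_mono)
    show "Max (set_pmf q) / W_E I \<in> {0} \<union> (\<lambda>v. v / W_E I) ` set_pmf q"
      using finite_support set_pmf_not_empty[of q] by (intro UnI2 imageI Max_in)
  qed (use finite_support in simp)
  finally show ?thesis .
qed

lemma approx_factor_le:
  assumes online: "online_algorithm I A"
  shows "approx_factor I A
    \<le> (s + (W_E I - s) * (1 - cdf (iid_sum m q) s) ^ (n - 1)) / W_E I"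
proof -
  let ?M = "\<lambda>y :: nat \<Rightarrow> real. MIN i\<in>{..<n}. y i"
  let ?S = "iid_sum m q"
  have "{s<..} = UNIV - {..s}" by auto
  then have tail: "measure_pmf.prob ?S {s<..} = 1 - cdf ?S s"
    using measure_pmf.prob_compl[of "{..s}" ?S] by (simp add: cdf_def2)
  have insert: "{..<n} = insert 0 {1..<n}" using n_pos by auto
  have "measure_pmf.expectation (run I A m) (objective I)
      \<le> measure_pmf.expectation (replicate_pmf m (type_pmf I))
          (\<lambda>js. ?M (\<lambda>i. \<Sum>j\<leftarrow>js. profit I i j 0))"
    using expectation_objective_le[OF online] by simp
  also have "\<dots> = measure_pmf.expectation (map_pmf (\<lambda>ys i. \<Sum>y\<leftarrow>ys. y i)
      (map_pmf (map (\<lambda>j i. profit I i j 0)) (replicate_pmf m (type_pmf I)))) ?M"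
    by (simp add: o_def)
  also have "\<dots> = measure_pmf.expectation (Pi_pmf {..<n} 0 (\<lambda>_. ?S)) ?M"
    by (simp only: map_replicate_pmf map_profit_type_pmf map_sum_replicate_Pi_pmf finite_lessThan)
  also have "\<dots> \<le> s + (measure_pmf.expectation ?S (\<lambda>x. x) - s) *
      (\<Prod>i\<in>{1..<n}. measure_pmf.prob ?S {s<..})"
    unfolding insert
    by (intro expectation_Min_Pi_pmf_le) (simp_all add: finite_set_pmf_iid_sum finite_support)
  also have "\<dots> = s + (W_E I - s) * (1 - cdf ?S s) ^ (n - 1)"
    by (simp add: expectation_iid_sum finite_support W_E_eq tail)
  finally show ?thesis
    unfolding approx_factor_def using W_E_nonneg by (simp add: divide_right_mono)
qed

end

section \<open>Random signs\<close>

definition rademacher :: "real pmf" where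
  "rademacher = pmf_of_set {- 1, 1}"

lemma set_pmf_rademacher: "set_pmf rademacher = {- 1, 1}"
  by (simp add: rademacher_def)

lemma expectation_rademacher:
  fixes f :: "real \<Rightarrow> real"
  shows "measure_pmf.expectation rademacher f = (f (- 1) + f 1) / 2"
  by (simp add: rademacher_def integral_pmf_of_set)

lemma second_moment_rademacher: "moment 2 rademacher = 1"
  by (simp add: moment_def expectation_rademacher)

interpretation rademacher: symmetric_platykurtic_pmf rademacher
proof
  show "map_pmf uminus rademacher = rademacher"
    unfolding rademacher_def by (subst map_pmf_of_set_inj) (auto simp: insert_commute)
qed (simp_all add: set_pmf_rademacher moment_def expectation_rademacher)

definition signed_share :: "nat \<Rightarrow> real \<Rightarrow> real pmf" where
  "signed_share m \<delta> = map_pmf (\<lambda>x. 1 / real m + \<delta> / real m * x) rademacher"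

lemma set_pmf_signed_share: "set_pmf (signed_share m \<delta>) = {(1 - \<delta>) / real m, (1 + \<delta>) / real m}"
  by (simp add: signed_share_def set_pmf_rademacher diff_divide_distrib add_divide_distrib)

locale sign_instance =
  fixes n m :: nat and \<delta> :: real
  assumes positive_sizes: "0 < n" "0 < m" and amplitude_bounds: "0 \<le> \<delta>" "\<delta> \<le> 1"
begin

sublocale iid_profits n m "signed_share m \<delta>"
  using positive_sizes amplitude_bounds by unfold_locales (auto simp: set_pmf_signed_share)

lemma W_E_eq_1: "W_E I = 1"
  using positive_sizes(2) unfolding W_E_eq by (simp add: signed_share_def expectation_rademacher)

lemma gamma_param_eq_amplitude: "gamma_param I = (1 + \<delta>) / real m"
proof -
  have "(1 - \<delta>) / real m \<le> (1 + \<delta>) / real m"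
    using amplitude_bounds by (intro divide_right_mono) auto
  then show ?thesis
    by (simp add: gamma_param_eq W_E_eq_1 set_pmf_signed_share)
qed

lemma approx_factor_le_cdf_rademacher:
  assumes online: "online_algorithm I A" and "0 < \<delta>"
  shows "approx_factor I A
    \<le> 1 - \<delta> * (s / real m) * (1 - (1 - cdf (iid_sum m rademacher) (- s)) ^ (n - 1))"
proof -
  have "1 + \<delta> / real m * x \<le> 1 - \<delta> * s / real m \<longleftrightarrow> x \<le> - s" for x
  proof -
    have "1 + \<delta> / real m * x \<le> 1 - \<delta> * s / real m \<longleftrightarrow> \<delta> / real m * x \<le> \<delta> / real m * - s"
      by auto
    also have "\<dots> \<longleftrightarrow> x \<le> - s"
      using \<open>0 < \<delta>\<close> positive_sizes(2) by (intro mult_le_cancel_left_pos) simp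
    finally show ?thesis .
  qed
  moreover have "iid_sum m (signed_share m \<delta>) =
      map_pmf (\<lambda>x. 1 + \<delta> / real m * x) (iid_sum m rademacher)"
    unfolding signed_share_def iid_sum_map_affine using positive_sizes(2) by simp
  ultimately have "cdf (iid_sum m (signed_share m \<delta>)) (1 - \<delta> * s / real m) =
      cdf (iid_sum m rademacher) (- s)"
    by (simp only: cdf_def2 measure_map_pmf vimage_def atMost_def mem_Collect_eq)
  with approx_factor_le[OF online, of "1 - \<delta> * s / real m"] show ?thesis
    by (simp add: W_E_eq_1 algebra_simps)
qed

end

section \<open>Choice of the parameters\<close>

definition request_count :: "nat \<Rightarrow> real \<Rightarrow> nat" where
  "request_count n \<epsilon> = nat \<lfloor>2 * ln (real n) / \<epsilon>\<^sup>2\<rfloor>"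

text \<open>
  The amplitude compensates for the rounding of the number of requests, so that \<open>(1 + \<delta>) / m\<close> is
  exactly \<open>\<epsilon>\<^sup>2 / ln n\<close>.
\<close>

definition amplitude :: "nat \<Rightarrow> real \<Rightarrow> real" where
  "amplitude n \<epsilon> = \<epsilon>\<^sup>2 * real (request_count n \<epsilon>) / ln (real n) - 1"

definition hard_instance :: "nat \<Rightarrow> real \<Rightarrow> allocation_instance" where
  "hard_instance n \<epsilon> =
     iid_profit_instance n (request_count n \<epsilon>) (signed_share (request_count n \<epsilon>) (amplitude n \<epsilon>))"

lemma ln_ge_two_thirds:
  assumes "n \<ge> 2"
  shows "2 / 3 \<le> ln (real n)"
proof -
  have "ln 2 \<le> ln (real n)" using assms by (intro ln_mono) auto
  with ln2_ge_two_thirds show ?thesis by linarith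
qed

lemma request_count_bounds:
  assumes "n \<ge> 2" "0 < \<epsilon>" "\<epsilon> < 1"
  shows "0 < request_count n \<epsilon>"
    and "2 * ln (real n) - \<epsilon>\<^sup>2 < \<epsilon>\<^sup>2 * real (request_count n \<epsilon>)"
    and "\<epsilon>\<^sup>2 * real (request_count n \<epsilon>) \<le> 2 * ln (real n)"
    and "ln (real n) \<le> \<epsilon>\<^sup>2 * real (request_count n \<epsilon>)"
proof -
  let ?m = "request_count n \<epsilon>" and ?x = "2 * ln (real n) / \<epsilon>\<^sup>2"
  have square_bounds: "0 < \<epsilon>\<^sup>2" "\<epsilon>\<^sup>2 < 1" using assms by (simp_all add: power_less_one_iff)
  have "1 \<le> ?x" using ln_ge_two_thirds[OF assms(1)] square_bounds by (simp add: le_divide_eq)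
  then have floor: "0 < ?m" "real ?m \<le> ?x" "?x < real ?m + 1"
    unfolding request_count_def by linarith+
  then show "0 < ?m" by simp
  show lower: "2 * ln (real n) - \<epsilon>\<^sup>2 < \<epsilon>\<^sup>2 * real ?m"
    using floor(3) square_bounds(1) by (simp add: divide_less_eq algebra_simps)
  show "\<epsilon>\<^sup>2 * real ?m \<le> 2 * ln (real n)"
    using floor(2) square_bounds(1) by (simp add: le_divide_eq mult.commute)
  have "\<epsilon>\<^sup>2 * 1 \<le> \<epsilon>\<^sup>2 * real ?m"
    using floor(1) by (intro mult_left_mono) auto
  with lower show "ln (real n) \<le> \<epsilon>\<^sup>2 * real ?m" by linarith
qed

lemma sign_instance_hard:
  assumes "n \<ge> 2" "0 < \<epsilon>" "\<epsilon> < 1"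
  shows "sign_instance n (request_count n \<epsilon>) (amplitude n \<epsilon>)"
proof -
  have "0 < ln (real n)" using assms(1) by simp
  then show ?thesis
    using request_count_bounds[OF assms] assms(1)
    by unfold_locales (simp_all add: amplitude_def divide_simps)
qed

lemma hard_instance_properties:
  assumes "n \<ge> 2" "0 < \<epsilon>" "\<epsilon> < 1"
  shows "valid_instance (hard_instance n \<epsilon>)" "num_resources (hard_instance n \<epsilon>) = n"
    "W_E (hard_instance n \<epsilon>) = 1" "gamma_param (hard_instance n \<epsilon>) = \<epsilon>\<^sup>2 / ln (real n)"
proof -
  interpret sign_instance n "request_count n \<epsilon>" "amplitude n \<epsilon>"
    by (rule sign_instance_hard[OF assms])
  show "valid_instance (hard_instance n \<epsilon>)" "num_resources (hard_instance n \<epsilon>) = n"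
    "W_E (hard_instance n \<epsilon>) = 1"
    using valid W_E_eq_1 by (simp_all add: hard_instance_def)
  show "gamma_param (hard_instance n \<epsilon>) = \<epsilon>\<^sup>2 / ln (real n)"
    using gamma_param_eq_amplitude positive_sizes(2) by (simp add: hard_instance_def amplitude_def)
qed

lemma amplitude_ge_half:
  assumes "n \<ge> 2" "0 < \<epsilon>" "\<epsilon> \<le> 1 / 2"
  shows "1 / 2 \<le> amplitude n \<epsilon>"
proof -
  have "\<epsilon>\<^sup>2 \<le> 1 / 4"
    using power_mono[of \<epsilon> "1 / 2" 2] assms by (simp add: power_divide)
  then have "3 / 2 * ln (real n) \<le> \<epsilon>\<^sup>2 * real (request_count n \<epsilon>)"
    using request_count_bounds(2)[of n \<epsilon>] ln_ge_two_thirds[of n] assms by simp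
  then show ?thesis
    using assms by (simp add: amplitude_def field_simps)
qed

lemma approx_factor_hard_instance_le:
  assumes "n \<ge> 2" "0 < \<epsilon>" "\<epsilon> \<le> 1 / 2" and online: "online_algorithm (hard_instance n \<epsilon>) A"
  shows "approx_factor (hard_instance n \<epsilon>) A \<le> 1 - \<epsilon> / 1526"
proof -
  have "\<epsilon> < 1" using assms by simp
  define m \<delta> where "m = request_count n \<epsilon>" and "\<delta> = amplitude n \<epsilon>"
  define s where "s = sqrt (real m * ln (real n) / 24)"
  interpret sign_instance n m \<delta>
    unfolding m_def \<delta>_def by (rule sign_instance_hard) fact+
  have m_bounds: "\<epsilon>\<^sup>2 * real m \<le> 2 * ln (real n)" "ln (real n) \<le> \<epsilon>\<^sup>2 * real m"
    using request_count_bounds[OF assms(1,2) \<open>\<epsilon> < 1\<close>] by (simp_all add: m_def)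
  have "\<epsilon>\<^sup>2 \<le> 1" using \<open>0 < \<epsilon>\<close> \<open>\<epsilon> < 1\<close> by (intro power_le_one) auto
  then have "ln (real n) \<le> 3 * real m"
    using m_bounds(2) mult_right_mono[of "\<epsilon>\<^sup>2" 1 "real m"] by simp
  then have minimum_small: "1 / 109 \<le> 1 - (1 - cdf (iid_sum m rademacher) (- s)) ^ (n - 1)"
    using rademacher.one_minus_cdf_iid_sum_power_ge[of n m] assms(1)
    by (simp add: s_def second_moment_rademacher)
  have "(\<epsilon> / 7 * real m)\<^sup>2 = \<epsilon>\<^sup>2 * real m * real m / 49"
    by (simp add: power2_eq_square)
  also have "\<dots> \<le> 2 * ln (real n) * real m / 48"
    using m_bounds(1) \<open>n \<ge> 2\<close> by (intro frac_le mult_right_mono) auto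
  also have "\<dots> = s\<^sup>2" using \<open>n \<ge> 2\<close> by (simp add: s_def)
  finally have "\<epsilon> / 7 * real m \<le> s"
    by (rule power2_le_imp_le) (use \<open>n \<ge> 2\<close> in \<open>simp add: s_def\<close>)
  then have deviation_ge: "\<epsilon> / 7 \<le> s / real m"
    using positive_sizes(2) by (simp add: field_simps)
  have \<delta>_ge: "1 / 2 \<le> \<delta>"
    unfolding \<delta>_def by (rule amplitude_ge_half) fact+
  have "\<epsilon> / 1526 = 1 / 2 * (\<epsilon> / 7) * (1 / 109)" by simp
  also have "\<dots> \<le> \<delta> * (s / real m) * (1 - (1 - cdf (iid_sum m rademacher) (- s)) ^ (n - 1))"
    using \<delta>_ge deviation_ge minimum_small \<open>0 < \<epsilon>\<close> order_trans[OF _ deviation_ge, of 0]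
    by (intro mult_mono mult_nonneg_nonneg) auto
  finally show ?thesis
    using approx_factor_le_cdf_rademacher[of A s] online \<delta>_ge
    by (simp add: hard_instance_def flip: m_def \<delta>_def)
qed

theorem theorem2:
  shows "\<exists>I :: nat \<Rightarrow> real \<Rightarrow> allocation_instance.
    (\<forall>n \<epsilon>. n \<ge> 2 \<and> 0 < \<epsilon> \<and> \<epsilon> < 1 \<longrightarrow>
       valid_instance (I n \<epsilon>) \<and> num_resources (I n \<epsilon>) = n \<and> W_E (I n \<epsilon>) > 0 \<and>
       gamma_param (I n \<epsilon>) = \<epsilon>\<^sup>2 / ln (real n)) \<and>
    (\<forall>f :: real \<Rightarrow> real. f \<in> o[at_right 0](\<lambda>\<epsilon>. \<epsilon>) \<longrightarrow>
       (\<forall>\<^sub>F \<epsilon> in at_right 0. \<forall>n\<ge>2.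
          \<not> (\<exists>A. online_algorithm (I n \<epsilon>) A \<and> approx_factor (I n \<epsilon>) A \<ge> 1 - f \<epsilon>)))"
proof (intro exI[of _ hard_instance] conjI allI impI)
  fix f :: "real \<Rightarrow> real" assume f_small: "f \<in> o[at_right 0](\<lambda>\<epsilon>. \<epsilon>)"
  have "\<forall>\<^sub>F \<epsilon> in at_right 0. norm (f \<epsilon>) \<le> 1 / 2000 * norm \<epsilon>"
    by (rule landau_o.smallD[OF f_small]) simp
  moreover have "\<forall>\<^sub>F \<epsilon> in at_right 0. \<epsilon> \<in> {0<..<1 / 2 :: real}"
    by (rule eventually_at_right_real) simp
  ultimately show "\<forall>\<^sub>F \<epsilon> in at_right 0. \<forall>n\<ge>2.
      \<not> (\<exists>A. online_algorithm (hard_instance n \<epsilon>) A \<and> approx_factor (hard_instance n \<epsilon>) A \<ge> 1 - f \<epsilon>)"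
  proof eventually_elim
    case (elim \<epsilon>)
    then have "1 - \<epsilon> / 1526 < 1 - f \<epsilon>" by auto
    with elim show ?case
      by (auto dest: approx_factor_hard_instance_le)
  qed
qed (auto simp: hard_instance_properties)

end
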